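(* Let $f=\frac1n\sum_{i=1}^n f_i$ with differentiable $f_i:\mathbb{R}^d\to\mathbb{R}$, and let $\mu,L>0$ be such that for all $v,w\in\mathbb{R}^d$ and $i=1,\dots,n$, $$f(w)\ge f(v)+\nabla f(v)^{\mathsf T}(w-v)+\frac{\mu}{2}\|v-w\|^2,\qquad \|\nabla f_i(v)-\nabla f_i(w)\|\le L\|v-w\|.$$ Let $x^*=\operatorname{argmin}_x f(x)$. If $m$ is chosen so that $$\rho=\frac{\kappa+4(1+1/m)\kappa}{\sqrt m-4\kappa}<1,$$ where $\kappa=L/\mu$ is the condition number, then the Stochastic Steffensen Method (SSM) with inner loop size $m$ converges linearly in expectation with $$\mathbb{E}[f(x_k)-f(x^* )]\le\rho^k[f(x_0)-f(x^* )].$$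
   Context: Stochastic Steffensen Method (SSM). Input: $x_0\in\mathbb{R}^d$ and a positive integer $m$ (the inner loop size). For $k=0,1,2,\dots$: compute $\nabla f(x_k)$ and $\nabla f(x_k+\nabla f(x_k))$ and set the learning rate $$\eta_k=\frac{1}{\sqrt m}\cdot\frac{\|\nabla f(x_k)\|^2}{[\nabla f(x_k+\nabla f(x_k))-\nabla f(x_k)]^{\mathsf T}\nabla f(x_k)};$$ set $x_{k,0}=x_k$; for $t=0,\dots,m-1$, sample $i_t\in\{1,\dots,n\}$ uniformly, set $v_{k,t}=\nabla f_{i_t}(x_{k,t})-\nabla f_{i_t}(x_k)+\nabla f(x_k)$ and $x_{k,t+1}=x_{k,t}-\eta_k v_{k,t}$; finally set $x_{k+1}=x_{k,i}$ for $i$ chosen uniformly from $\{0,\dots,m-1\}$.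
   Formalization: Each f_i is additionally assumed convex (without this the claim fails, e.g. f_1=50x^2, f_2=-49x^2, m=10^6), and sqrt(m) > 4κ is assumed so that ρ has a positive denominator (otherwise ρ is negative or undefined). *)

theory Defs
  imports "HOL-Probability.Probability"
begin

definition gradient :: "('a::real_inner \<Rightarrow> real) \<Rightarrow> 'a \<Rightarrow> 'a" where
  "gradient f x = (THE D. GDERIV f x :> D)"

lemma gradient_eqI:
  assumes "GDERIV f x :> D"
  shows "gradient f x = D"
  unfolding gradient_def
proof (rule the_equality)
  show "GDERIV f x :> D" by (fact assms)
next
  fix D' assume "GDERIV f x :> D'"
  with assms have "(\<lambda>h. inner h D') = (\<lambda>h. inner h D)"
    unfolding gderiv_def by (rule has_derivative_unique[rotated])
  then have "inner (D' - D) D' = inner (D' - D) D" by metis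
  then have "inner (D' - D) (D' - D) = 0" by (simp add: inner_diff_right)
  then show "D' = D" by simp
qed

lemma GDERIV_gradient:
  fixes f :: "'a::euclidean_space \<Rightarrow> real"
  assumes "f differentiable (at x)"
  shows "GDERIV f x :> gradient f x"
proof -
  obtain F where F: "(f has_derivative F) (at x)"
    using assms by (auto simp: differentiable_def)
  then interpret bounded_linear F by (rule has_derivative_bounded_linear)
  have "F h = inner h (\<Sum>b\<in>Basis. F b *\<^sub>R b)" for h
  proof -
    have "F h = F (\<Sum>b\<in>Basis. inner h b *\<^sub>R b)" by (simp add: euclidean_representation)
    also have "\<dots> = inner h (\<Sum>b\<in>Basis. F b *\<^sub>R b)"
      by (simp add: sum scaleR inner_sum_right mult.commute)
    finally show ?thesis .
  qed
  then have "F = (\<lambda>h. inner h (\<Sum>b\<in>Basis. F b *\<^sub>R b))" by blast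
  with F have "GDERIV f x :> (\<Sum>b\<in>Basis. F b *\<^sub>R b)"
    unfolding gderiv_def by simp
  then show ?thesis using gradient_eqI by metis
qed

definition avg :: "nat \<Rightarrow> (nat \<Rightarrow> 'a \<Rightarrow> real) \<Rightarrow> 'a \<Rightarrow> real" where
  "avg n fs x = (1 / real n) * (\<Sum>i=1..n. fs i x)"

text \<open>If the gradient of \<open>f\<close> vanishes at \<open>x\<close>, the learning rate is the undefined quotient 0/0,
  which HOL evaluates to 0.  The value is immaterial: the directions of the inner loop are then 0
  at \<open>x\<close>, so every inner iterate is \<open>x\<close> for any learning rate.\<close>

definition learning_rate :: "('a::real_inner \<Rightarrow> real) \<Rightarrow> nat \<Rightarrow> 'a \<Rightarrow> real" where
  "learning_rate f m x =
     1 / sqrt (real m) *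
     ((norm (gradient f x))\<^sup>2 / inner (gradient f (x + gradient f x) - gradient f x) (gradient f x))"

text \<open>The inner iterate with index \<open>t\<close> of an outer iteration that starts at \<open>x\<close>, as a function of
  the list \<open>is\<close> of the indices sampled in it; \<open>is ! t\<close> is the index used to go from iterate \<open>t\<close> to
  iterate \<open>Suc t\<close>.\<close>

primrec inner_iterate ::
    "nat \<Rightarrow> (nat \<Rightarrow> 'a::real_inner \<Rightarrow> real) \<Rightarrow> nat \<Rightarrow> 'a \<Rightarrow> nat list \<Rightarrow> nat \<Rightarrow> 'a" where
  "inner_iterate n fs m x is 0 = x"
| "inner_iterate n fs m x is (Suc t) =
     (let y = inner_iterate n fs m x is t;
          v = gradient (fs (is ! t)) y - gradient (fs (is ! t)) x + gradient (avg n fs) x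
      in y - learning_rate (avg n fs) m x *\<^sub>R v)"

definition ssm_step :: "nat \<Rightarrow> (nat \<Rightarrow> 'a::real_inner \<Rightarrow> real) \<Rightarrow> nat \<Rightarrow> 'a \<Rightarrow> 'a pmf" where
  "ssm_step n fs m x = do {
     is \<leftarrow> replicate_pmf m (pmf_of_set {1..n});
     j \<leftarrow> pmf_of_set {0..<m};
     return_pmf (inner_iterate n fs m x is j)
   }"

text \<open>The law of the outer iterate with index \<open>k\<close>, started at \<open>x0\<close>.  All samples of all iterations
  are independent.\<close>

primrec ssm :: "nat \<Rightarrow> (nat \<Rightarrow> 'a::real_inner \<Rightarrow> real) \<Rightarrow> nat \<Rightarrow> 'a \<Rightarrow> nat \<Rightarrow> 'a pmf" where
  "ssm n fs m x0 0 = return_pmf x0"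
| "ssm n fs m x0 (Suc k) = bind_pmf (ssm n fs m x0 k) (ssm_step n fs m)"

end

theory Submission
  imports Defs
begin

text \<open>
  Write \<open>gap x\<close> for \<open>f x - f xstar\<close>.  One outer iteration from \<open>x\<close> multiplies the expected gap by
  at most \<open>3 * \<kappa> / (sqrt m - 2 * \<kappa>)\<close>, and this number is at most \<open>\<rho>\<close>; since the outer iterates
  form a Markov chain, induction over \<open>k\<close> gives the theorem.

  The contraction rests on two facts.  The first is that the variance of the inner direction is
  controlled by the gaps: for a convex function with \<open>L\<close>-Lipschitz gradient, a squared gradient
  difference is at most \<open>2 * L\<close> times the error of the first-order Taylor polynomial
  (\<open>convex_smooth_gradient_diff_bound\<close>).  Averaged over the components, with base point \<open>xstar\<close>,
  the linear terms cancel, and the second moment of the direction at \<open>y\<close> is at most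
  \<open>4 * L * (gap y + gap x)\<close> (\<open>sum_direction_norm_squared_le\<close>).  The direction is also an unbiased
  estimate of the gradient at \<open>y\<close>.  So an inner step with learning rate \<open>\<eta>\<close> changes the expected
  squared distance to \<open>xstar\<close> by at most
  \<open>- 2 * \<eta> * (1 - 2 * L * \<eta>) * gap y + 4 * L * \<eta>\<^sup>2 * gap x\<close>.  Summed over the \<open>m\<close> inner steps, the
  distances telescope, and the initial one is at most \<open>2 / \<mu> * gap x\<close> by strong convexity.  As the
  next outer iterate is a uniformly chosen inner iterate, its expected gap is the mean of the
  expected gaps of the inner loop (\<open>sum_expected_gap_le\<close>, \<open>expectation_ssm_step\<close>).

  The second fact is that the Steffensen learning rate lies between \<open>1 / (sqrt m * L)\<close> and
  \<open>1 / (sqrt m * \<mu>)\<close> (\<open>learning_rate_bounds\<close>).  Then both \<open>L * \<eta>\<close> and \<open>1 / (\<mu> * \<eta> * m)\<close> are at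
  most \<open>\<kappa> / sqrt m\<close>, and inserting this in the summed estimate gives the contraction factor.
\<close>

section \<open>Smooth and convex functions\<close>

lemma GDERIV_along_line:
  assumes "GDERIV h (x + s *\<^sub>R d) :> D"
  shows "((\<lambda>t. h (x + t *\<^sub>R d)) has_real_derivative inner d D) (at s)"
proof -
  have "((\<lambda>t. h (x + t *\<^sub>R d)) has_derivative (\<lambda>t. inner (t *\<^sub>R d) D)) (at s)"
    using assms unfolding gderiv_def
    by (rule has_derivative_compose[rotated, of h _ "\<lambda>t. x + t *\<^sub>R d"])
       (auto intro!: derivative_eq_intros)
  then show ?thesis
    by (simp add: has_field_derivative_def mult_commute_abs mult.commute)
qed

lemma convex_above_tangent_plane:
  assumes "convex_on UNIV h" and "GDERIV h x :> D"
  shows "h y \<ge> h x + inner D (y - x)"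
proof -
  have "convex_on UNIV (\<lambda>t::real. h (x + t *\<^sub>R (y - x)))"
  proof (rule convex_onI)
    fix t a b :: real assume "0 < t" "t < 1"
    have "x + ((1 - t) *\<^sub>R a + t *\<^sub>R b) *\<^sub>R (y - x)
        = (1 - t) *\<^sub>R (x + a *\<^sub>R (y - x)) + t *\<^sub>R (x + b *\<^sub>R (y - x))"
      by (simp add: algebra_simps)
    then show "h (x + ((1 - t) *\<^sub>R a + t *\<^sub>R b) *\<^sub>R (y - x))
        \<le> (1 - t) * h (x + a *\<^sub>R (y - x)) + t * h (x + b *\<^sub>R (y - x))"
      using convex_onD[OF assms(1), of t] \<open>0 < t\<close> \<open>t < 1\<close> by simp
  qed simp
  moreover have "((\<lambda>t. h (x + t *\<^sub>R (y - x))) has_real_derivative inner (y - x) D) (at 0)"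
    using assms(2) by (intro GDERIV_along_line) simp
  ultimately show ?thesis
    using convex_on_imp_above_tangent[of UNIV "\<lambda>t. h (x + t *\<^sub>R (y - x))" 0 1]
    by (fastforce simp: inner_commute)
qed

text \<open>Along the segment from \<open>x\<close> to \<open>y\<close>, the difference of the two sides has nonpositive
  derivative, because the slope of \<open>h\<close> at parameter \<open>t\<close> exceeds the initial slope by at most
  \<open>L t\<close> times the squared length of the segment.\<close>

lemma smooth_below_quadratic:
  assumes deriv: "\<And>x. GDERIV h x :> g x"
    and lipschitz: "\<And>v w. norm (g v - g w) \<le> L * norm (v - w)"
  shows "h y \<le> h x + inner (g x) (y - x) + L / 2 * (norm (y - x))\<^sup>2"
proof -
  define d where "d = y - x"
  define \<psi> where "\<psi> t = h (x + t *\<^sub>R d) - t * inner d (g x) - L / 2 * t\<^sup>2 * (norm d)\<^sup>2" for t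
  have slope: "\<exists>D. (\<psi> has_real_derivative D) (at t) \<and> D \<le> 0" if "0 \<le> t" for t
  proof (intro exI conjI)
    show "(\<psi> has_real_derivative
        inner d (g (x + t *\<^sub>R d)) - inner d (g x) - L * t * (norm d)\<^sup>2) (at t)"
      unfolding \<psi>_def by (auto intro!: derivative_eq_intros GDERIV_along_line deriv)
    have "inner d (g (x + t *\<^sub>R d) - g x) \<le> norm d * norm (g (x + t *\<^sub>R d) - g x)"
      by (rule norm_cauchy_schwarz)
    also have "\<dots> \<le> norm d * (L * norm (t *\<^sub>R d))"
      using lipschitz[of "x + t *\<^sub>R d" x] by (intro mult_left_mono) auto
    also have "\<dots> = L * t * (norm d)\<^sup>2"
      using that by (simp add: power2_eq_square)
    finally show "inner d (g (x + t *\<^sub>R d)) - inner d (g x) - L * t * (norm d)\<^sup>2 \<le> 0"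
      by (simp add: inner_diff_right)
  qed
  have "\<psi> 1 \<le> \<psi> 0"
    by (rule DERIV_nonpos_imp_nonincreasing[OF _ slope]) simp_all
  then show ?thesis
    by (simp add: \<psi>_def d_def inner_commute)
qed

text \<open>The step of length \<open>1 / L\<close> along the negative gradient minimizes the quadratic upper bound.\<close>

lemma smooth_gradient_step_decrease:
  assumes "\<And>x. GDERIV h x :> g x"
    and "\<And>v w. norm (g v - g w) \<le> L * norm (v - w)" and "L > 0"
  shows "h (x - (1 / L) *\<^sub>R g x) \<le> h x - (norm (g x))\<^sup>2 / (2 * L)"
proof -
  have "h (x - (1 / L) *\<^sub>R g x)
      \<le> h x + inner (g x) (- (1 / L) *\<^sub>R g x) + L / 2 * (norm ((1 / L) *\<^sub>R g x))\<^sup>2"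
    using smooth_below_quadratic[OF assms(1,2), of "x - (1 / L) *\<^sub>R g x" x] by simp
  also have "\<dots> = h x - (norm (g x))\<^sup>2 / (2 * L)"
    using \<open>L > 0\<close> by (simp add: power_mult_distrib power_divide power2_norm_eq_inner)
      (simp add: field_simps power2_eq_square)
  finally show ?thesis .
qed

text \<open>Subtracting from \<open>h\<close> its tangent plane at \<open>z\<close> leaves a smooth function that, by convexity,
  is minimal at \<open>z\<close>; a gradient step from \<open>y\<close> cannot take it below that minimum.\<close>

lemma convex_smooth_gradient_diff_bound:
  assumes convex: "convex_on UNIV h" and deriv: "\<And>x. GDERIV h x :> g x"
    and lipschitz: "\<And>v w. norm (g v - g w) \<le> L * norm (v - w)" and "L > 0"
  shows "(norm (g y - g z))\<^sup>2 \<le> 2 * L * (h y - h z - inner (g z) (y - z))"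
proof -
  define \<phi> where "\<phi> x = h x - inner x (g z)" for x
  have "GDERIV \<phi> x :> g x - g z" for x
    unfolding \<phi>_def
    by (intro GDERIV_diff deriv)
       (simp add: gderiv_def bounded_linear_imp_has_derivative bounded_linear_inner_left)
  then have "\<phi> (y - (1 / L) *\<^sub>R (g y - g z)) \<le> \<phi> y - (norm (g y - g z))\<^sup>2 / (2 * L)"
    using lipschitz \<open>L > 0\<close> by (intro smooth_gradient_step_decrease) auto
  moreover have "\<phi> z \<le> \<phi> x" for x
    using convex_above_tangent_plane[OF convex deriv, of z x]
    by (simp add: \<phi>_def inner_diff_right inner_commute)
  ultimately have "\<phi> z \<le> \<phi> y - (norm (g y - g z))\<^sup>2 / (2 * L)"
    using order_trans by blast
  then show ?thesis
    using \<open>L > 0\<close> by (simp add: \<phi>_def inner_diff_right inner_commute field_simps)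
qed

section \<open>Expectations over finitely supported laws\<close>

lemma expectation_bind_finite:
  fixes h :: "'b \<Rightarrow> real"
  assumes "finite (set_pmf p)" and "\<And>x. x \<in> set_pmf p \<Longrightarrow> finite (set_pmf (q x))"
  shows "measure_pmf.expectation (p \<bind> q) h
    = measure_pmf.expectation p (\<lambda>x. measure_pmf.expectation (q x) h)"
  using assms pmf_expectation_bind[OF assms(1,2) order_refl, where h = h]
  by (simp add: integral_measure_pmf[of "set_pmf p"])

section \<open>Minimizing a strongly convex average\<close>

locale finite_sum_minimization =
  fixes n :: nat and fs :: "nat \<Rightarrow> 'a::euclidean_space \<Rightarrow> real"
    and \<mu> L :: real and xstar :: 'a
  assumes n_pos: "n \<ge> 1"
    and differentiable: "\<And>i x. i \<in> {1..n} \<Longrightarrow> fs i differentiable (at x)"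
    and convex: "\<And>i. i \<in> {1..n} \<Longrightarrow> convex_on UNIV (fs i)"
    and \<mu>_pos: "\<mu> > 0" and L_pos: "L > 0"
    and strongly_convex: "\<And>v w. avg n fs w \<ge>
        avg n fs v + inner (gradient (avg n fs) v) (w - v) + \<mu> / 2 * (norm (v - w))\<^sup>2"
    and lipschitz: "\<And>i v w. i \<in> {1..n} \<Longrightarrow>
        norm (gradient (fs i) v - gradient (fs i) w) \<le> L * norm (v - w)"
    and minimal: "\<And>x. avg n fs xstar \<le> avg n fs x"
begin

abbreviation "f \<equiv> avg n fs"
abbreviation "gap x \<equiv> f x - f xstar"

lemma GDERIV_component: "i \<in> {1..n} \<Longrightarrow> GDERIV (fs i) x :> gradient (fs i) x"
  by (intro GDERIV_gradient differentiable)

lemma GDERIV_average: "GDERIV f x :> (1 / real n) *\<^sub>R (\<Sum>i=1..n. gradient (fs i) x)"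
proof -
  have "(f has_derivative
      (\<lambda>h. (1 / real n) * (\<Sum>i=1..n. inner h (gradient (fs i) x)))) (at x)"
    unfolding avg_def[abs_def]
    by (intro has_derivative_mult_right has_derivative_sum)
       (use GDERIV_component in \<open>auto simp: gderiv_def\<close>)
  then show ?thesis
    by (simp add: gderiv_def inner_sum_right)
qed

lemma sum_gradients: "(\<Sum>i=1..n. gradient (fs i) x) = real n *\<^sub>R gradient f x"
  using gradient_eqI[OF GDERIV_average] n_pos by simp

lemma GDERIV_f: "GDERIV f x :> gradient f x"
  using GDERIV_average gradient_eqI[OF GDERIV_average] by simp

lemma lipschitz_f: "norm (gradient f v - gradient f w) \<le> L * norm (v - w)"
proof -
  have "real n * norm (gradient f v - gradient f w)
      = norm (real n *\<^sub>R gradient f v - real n *\<^sub>R gradient f w)"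
    by (simp flip: scaleR_diff_right)
  also have "\<dots> = norm (\<Sum>i=1..n. gradient (fs i) v - gradient (fs i) w)"
    by (simp only: sum_subtractf sum_gradients)
  also have "\<dots> \<le> (\<Sum>i=1..n. L * norm (v - w))"
    by (intro sum_norm_le lipschitz)
  finally show ?thesis
    using n_pos by simp
qed

text \<open>Otherwise a gradient step from \<open>xstar\<close> would lead below the minimum.\<close>

lemma gradient_xstar: "gradient f xstar = 0"
proof -
  have "f xstar \<le> f xstar - (norm (gradient f xstar))\<^sup>2 / (2 * L)"
    using minimal smooth_gradient_step_decrease[OF GDERIV_f lipschitz_f L_pos] order_trans by blast
  then have "(norm (gradient f xstar))\<^sup>2 \<le> 0"
    using L_pos by (simp add: field_simps)
  then show ?thesis by simp
qed

lemma gap_nonneg: "0 \<le> gap x"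
  using minimal[of x] by simp

lemma distance_le_gap: "(norm (x - xstar))\<^sup>2 \<le> 2 / \<mu> * gap x"
  using strongly_convex[of xstar x] \<mu>_pos
  by (simp add: gradient_xstar norm_minus_commute field_simps)

lemma gap_le_inner: "gap y \<le> inner (y - xstar) (gradient f y)"
proof -
  have "0 \<le> \<mu> / 2 * (norm (y - xstar))\<^sup>2"
    using \<mu>_pos by simp
  moreover have "inner (gradient f y) (xstar - y) = - inner (y - xstar) (gradient f y)"
    by (metis inner_commute inner_minus_left minus_diff_eq)
  ultimately show ?thesis
    using strongly_convex[of y xstar] by simp
qed

lemma strongly_monotone:
  "\<mu> * (norm (w - v))\<^sup>2 \<le> inner (gradient f w - gradient f v) (w - v)"
  using strongly_convex[of v w] strongly_convex[of w v]
  by (simp add: norm_minus_commute inner_diff_left inner_diff_right)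

section \<open>The variance-reduced direction\<close>

text \<open>The linear terms add up to a multiple of the gradient of \<open>f\<close> at \<open>xstar\<close>, which is 0.\<close>

lemma sum_gradient_diffs_le_gap:
  "(\<Sum>i=1..n. (norm (gradient (fs i) y - gradient (fs i) xstar))\<^sup>2) \<le> real n * (2 * L * gap y)"
proof -
  have "(\<Sum>i=1..n. (norm (gradient (fs i) y - gradient (fs i) xstar))\<^sup>2)
      \<le> (\<Sum>i=1..n. 2 * L * (fs i y - fs i xstar - inner (gradient (fs i) xstar) (y - xstar)))"
    using convex GDERIV_component lipschitz L_pos
    by (intro sum_mono convex_smooth_gradient_diff_bound) auto
  also have "\<dots> = 2 * L * ((\<Sum>i=1..n. fs i y) - (\<Sum>i=1..n. fs i xstar)
      - inner (\<Sum>i=1..n. gradient (fs i) xstar) (y - xstar))"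
    by (simp add: sum_subtractf inner_sum_left flip: sum_distrib_left)
  also have "\<dots> = real n * (2 * L * gap y)"
    using n_pos unfolding sum_gradients gradient_xstar by (simp add: avg_def field_simps)
  finally show ?thesis .
qed

definition direction :: "'a \<Rightarrow> 'a \<Rightarrow> nat \<Rightarrow> 'a" where
  "direction x y i = gradient (fs i) y - gradient (fs i) x + gradient f x"

lemma sum_direction: "(\<Sum>i=1..n. direction x y i) = real n *\<^sub>R gradient f y"
  unfolding direction_def sum.distrib sum_subtractf sum_gradients sum_constant_scaleR
  by simp

text \<open>The direction is split at the component gradients at \<open>xstar\<close>.  One part is the gradient
  difference between \<open>y\<close> and \<open>xstar\<close>.  The other is that between \<open>x\<close> and \<open>xstar\<close> minus its own
  mean, so its second moment is a variance and at most the second moment of the difference.\<close>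

lemma sum_direction_norm_squared_le:
  "(\<Sum>i=1..n. (norm (direction x y i))\<^sup>2) \<le> real n * (4 * L * (gap y + gap x))"
proof -
  define p where "p z i = gradient (fs i) z - gradient (fs i) xstar" for z i
  define g where "g = gradient f x"
  have sum_p: "(\<Sum>i=1..n. p x i) = real n *\<^sub>R g"
    unfolding p_def g_def sum_subtractf sum_gradients by (simp add: gradient_xstar)
  have "(\<Sum>i=1..n. (norm (p x i - g))\<^sup>2)
      = (\<Sum>i=1..n. (norm (p x i))\<^sup>2 - 2 * inner (p x i) g + (norm g)\<^sup>2)"
    by (intro sum.cong refl) (simp add: power2_norm_eq_inner algebra_simps inner_commute)
  also have "\<dots> = (\<Sum>i=1..n. (norm (p x i))\<^sup>2) - 2 * inner (\<Sum>i=1..n. p x i) g + real n * (norm g)\<^sup>2"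
    by (simp add: sum.distrib sum_subtractf inner_sum_left sum_distrib_left)
  also have "\<dots> = (\<Sum>i=1..n. (norm (p x i))\<^sup>2) - real n * (norm g)\<^sup>2"
    unfolding sum_p by (simp add: power2_norm_eq_inner)
  finally have variance: "(\<Sum>i=1..n. (norm (p x i - g))\<^sup>2) \<le> (\<Sum>i=1..n. (norm (p x i))\<^sup>2)"
    by simp
  have "(norm (direction x y i))\<^sup>2 \<le> 2 * (norm (p y i))\<^sup>2 + 2 * (norm (p x i - g))\<^sup>2" for i
  proof -
    have "0 \<le> (norm (p y i + (p x i - g)))\<^sup>2"
      by simp
    moreover have "direction x y i = p y i - (p x i - g)"
      by (simp add: direction_def p_def g_def)
    ultimately show ?thesis
      by (simp only: power2_norm_eq_inner) (simp add: algebra_simps inner_commute)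
  qed
  then have "(\<Sum>i=1..n. (norm (direction x y i))\<^sup>2)
      \<le> (\<Sum>i=1..n. 2 * (norm (p y i))\<^sup>2 + 2 * (norm (p x i - g))\<^sup>2)"
    by (rule sum_mono)
  also have "\<dots> \<le> 2 * (\<Sum>i=1..n. (norm (p y i))\<^sup>2) + 2 * (\<Sum>i=1..n. (norm (p x i))\<^sup>2)"
    using variance by (simp add: sum.distrib flip: sum_distrib_left)
  also have "\<dots> \<le> 2 * (real n * (2 * L * gap y)) + 2 * (real n * (2 * L * gap x))"
    using sum_gradient_diffs_le_gap unfolding p_def by (intro add_mono mult_left_mono) auto
  finally show ?thesis
    by (simp add: algebra_simps)
qed

text \<open>Expanding the square, the cross term is governed by the mean direction, which is the gradient
  at \<open>y\<close>, and the quadratic term by the second moment of the direction.\<close>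

lemma sum_step_distance_le:
  assumes "\<eta> \<ge> 0"
  shows "(\<Sum>i=1..n. (norm (y - \<eta> *\<^sub>R direction x y i - xstar))\<^sup>2)
    \<le> real n * ((norm (y - xstar))\<^sup>2 - 2 * \<eta> * (1 - 2 * L * \<eta>) * gap y + 4 * L * \<eta>\<^sup>2 * gap x)"
proof -
  define a where "a = y - xstar"
  have "(norm (y - \<eta> *\<^sub>R direction x y i - xstar))\<^sup>2
      = (norm a)\<^sup>2 - 2 * \<eta> * inner a (direction x y i) + \<eta>\<^sup>2 * (norm (direction x y i))\<^sup>2" for i
  proof -
    have "y - \<eta> *\<^sub>R direction x y i - xstar = a - \<eta> *\<^sub>R direction x y i"
      by (simp add: a_def)
    then show ?thesis
      by (simp only: power2_norm_eq_inner)
         (simp add: inner_diff_left inner_diff_right inner_commute power2_eq_square algebra_simps)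
  qed
  then have "(\<Sum>i=1..n. (norm (y - \<eta> *\<^sub>R direction x y i - xstar))\<^sup>2)
      = real n * (norm a)\<^sup>2 - 2 * \<eta> * inner a (\<Sum>i=1..n. direction x y i)
        + \<eta>\<^sup>2 * (\<Sum>i=1..n. (norm (direction x y i))\<^sup>2)"
    by (simp add: sum.distrib sum_subtractf inner_sum_right sum_distrib_left)
  also have "\<dots> \<le> real n * (norm a)\<^sup>2 - 2 * \<eta> * (real n * gap y)
        + \<eta>\<^sup>2 * (real n * (4 * L * (gap y + gap x)))"
    unfolding sum_direction inner_scaleR_right using assms gap_le_inner[of y]
    by (intro add_mono diff_mono mult_left_mono sum_direction_norm_squared_le) (auto simp: a_def)
  finally show ?thesis
    by (simp add: a_def algebra_simps power2_eq_square)
qed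

text \<open>The denominator of the Steffensen learning rate is the increment of the gradient along a
  step equal to the gradient, so the learning rate is \<open>1 / sqrt m\<close> times the inverse of a
  curvature, which lies between \<open>\<mu>\<close> and \<open>L\<close>.\<close>

lemma learning_rate_bounds:
  assumes "gradient f x \<noteq> 0" and "m \<ge> 1"
  shows "1 / (sqrt (real m) * L) \<le> learning_rate f m x"
    and "learning_rate f m x \<le> 1 / (sqrt (real m) * \<mu>)"
proof -
  define g where "g = gradient f x"
  define c where "c = inner (gradient f (x + g) - gradient f x) g"
  have g: "(norm g)\<^sup>2 > 0"
    using assms by (simp add: g_def)
  have lower: "\<mu> * (norm g)\<^sup>2 \<le> c"
    using strongly_monotone[of "x + g" x] by (simp add: c_def)
  have "c \<le> norm (gradient f (x + g) - gradient f x) * norm g"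
    unfolding c_def by (rule norm_cauchy_schwarz)
  also have "\<dots> \<le> L * norm g * norm g"
    using lipschitz_f[of "x + g" x] by (intro mult_right_mono) auto
  finally have upper: "c \<le> L * (norm g)\<^sup>2"
    by (simp add: power2_eq_square mult.assoc)
  have c: "c > 0"
    using lower g \<mu>_pos by (smt (verit) mult_pos_pos)
  have "1 / L \<le> (norm g)\<^sup>2 / c"
    using upper c L_pos by (simp add: field_simps)
  moreover have "(norm g)\<^sup>2 / c \<le> 1 / \<mu>"
    using lower c \<mu>_pos by (simp add: field_simps)
  moreover have "learning_rate f m x = 1 / sqrt (real m) * ((norm g)\<^sup>2 / c)"
    by (simp add: learning_rate_def g_def c_def)
  moreover have "1 / (sqrt (real m) * r) = 1 / sqrt (real m) * (1 / r)" for r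
    by simp
  ultimately show "1 / (sqrt (real m) * L) \<le> learning_rate f m x"
      and "learning_rate f m x \<le> 1 / (sqrt (real m) * \<mu>)"
    by (simp_all only:) (intro mult_left_mono; simp)+
qed

section \<open>The inner loop as a Markov chain\<close>

text \<open>The law of a single inner iterate: given iterate \<open>t\<close>, the next one uses a fresh index, so the
  expectation of a step can be taken conditionally on the current iterate.\<close>

primrec inner_law :: "nat \<Rightarrow> 'a \<Rightarrow> nat \<Rightarrow> 'a pmf" where
  "inner_law m x 0 = return_pmf x"
| "inner_law m x (Suc t) = do {
     y \<leftarrow> inner_law m x t;
     i \<leftarrow> pmf_of_set {1..n};
     return_pmf (y - learning_rate f m x *\<^sub>R direction x y i)
   }"

lemma inner_iterate_append:
  "t \<le> length js \<Longrightarrow> inner_iterate n fs m x (js @ ks) t = inner_iterate n fs m x js t"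
  by (induction t) (auto simp: nth_append Let_def)

lemma map_pmf_inner_iterate_replicate:
  "map_pmf (\<lambda>js. inner_iterate n fs m x js t) (replicate_pmf t (pmf_of_set {1..n}))
    = inner_law m x t"
proof (induction t)
  case 0
  then show ?case by simp
next
  case (Suc t)
  let ?P = "pmf_of_set {1..n}" and ?I = "inner_iterate n fs m x"
  have "map_pmf (\<lambda>js. ?I js (Suc t)) (replicate_pmf (Suc t) ?P)
      = do {js \<leftarrow> replicate_pmf t ?P; i \<leftarrow> ?P; return_pmf (?I (js @ [i]) (Suc t))}"
    using replicate_pmf_distrib[of t 1 ?P]
    by (simp del: replicate_pmf.simps(2) add: replicate_pmf_1[unfolded One_nat_def]
        map_pmf_def bind_assoc_pmf bind_return_pmf)
  also have "\<dots> = do {js \<leftarrow> replicate_pmf t ?P; i \<leftarrow> ?P;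
      return_pmf (?I js t - learning_rate f m x *\<^sub>R direction x (?I js t) i)}"
    by (intro bind_pmf_cong refl)
       (auto simp: set_replicate_pmf inner_iterate_append nth_append Let_def direction_def)
  also have "\<dots> = inner_law m x (Suc t)"
    by (simp add: map_pmf_def bind_assoc_pmf bind_return_pmf flip: Suc.IH)
  finally show ?case .
qed

text \<open>An inner iterate depends only on the indices sampled before it; the later ones integrate out.\<close>

lemma map_pmf_inner_iterate:
  assumes "t \<le> N"
  shows "map_pmf (\<lambda>js. inner_iterate n fs m x js t) (replicate_pmf N (pmf_of_set {1..n}))
    = inner_law m x t"
proof -
  let ?P = "pmf_of_set {1..n}" and ?I = "inner_iterate n fs m x"
  have "map_pmf (\<lambda>js. ?I js t) (replicate_pmf N ?P)
      = do {js \<leftarrow> replicate_pmf t ?P; ks \<leftarrow> replicate_pmf (N - t) ?P; return_pmf (?I (js @ ks) t)}"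
    using replicate_pmf_distrib[of t "N - t" ?P] assms
    by (simp add: map_pmf_def bind_assoc_pmf bind_return_pmf)
  also have "\<dots> = do {js \<leftarrow> replicate_pmf t ?P; ks \<leftarrow> replicate_pmf (N - t) ?P;
      return_pmf (?I js t)}"
    by (intro bind_pmf_cong refl) (auto simp: set_replicate_pmf inner_iterate_append)
  also have "\<dots> = map_pmf (\<lambda>js. ?I js t) (replicate_pmf t ?P)"
    by (simp add: map_pmf_def)
  finally show ?thesis
    by (simp only: map_pmf_inner_iterate_replicate)
qed

lemma set_pmf_component_index: "set_pmf (pmf_of_set {1..n}) = {1..n}"
  using n_pos by (intro set_pmf_of_set) auto

lemma finite_inner_law: "finite (set_pmf (inner_law m x t))"
  using set_pmf_component_index by (induction t) auto

lemma expectation_inner_law_Suc: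
  fixes h :: "'a \<Rightarrow> real"
  shows "measure_pmf.expectation (inner_law m x (Suc t)) h = measure_pmf.expectation (inner_law m x t)
    (\<lambda>y. (\<Sum>i=1..n. h (y - learning_rate f m x *\<^sub>R direction x y i)) / real n)"
proof -
  have "measure_pmf.expectation (pmf_of_set {1..n} \<bind> (\<lambda>i. return_pmf (g i))) h
      = (\<Sum>i=1..n. h (g i)) / real n" for g :: "nat \<Rightarrow> 'a"
    using n_pos by (subst pmf_expectation_bind_pmf_of_set) (auto simp: sum_divide_distrib field_simps)
  then show ?thesis
    using finite_inner_law set_pmf_component_index
    by (simp add: expectation_bind_finite)
qed

lemma expectation_distance_step:
  fixes m :: nat and x :: 'a
  defines "\<eta> \<equiv> learning_rate f m x"
  assumes "\<eta> \<ge> 0"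
  shows "measure_pmf.expectation (inner_law m x (Suc t)) (\<lambda>y. (norm (y - xstar))\<^sup>2)
    \<le> measure_pmf.expectation (inner_law m x t) (\<lambda>y. (norm (y - xstar))\<^sup>2)
      - 2 * \<eta> * (1 - 2 * L * \<eta>) * measure_pmf.expectation (inner_law m x t) gap
      + 4 * L * \<eta>\<^sup>2 * gap x"
proof -
  have integrable: "integrable (inner_law m x t) h" for h :: "'a \<Rightarrow> real"
    by (rule integrable_measure_pmf_finite[OF finite_inner_law])
  have "measure_pmf.expectation (inner_law m x (Suc t)) (\<lambda>y. (norm (y - xstar))\<^sup>2)
      \<le> measure_pmf.expectation (inner_law m x t) (\<lambda>y. (norm (y - xstar))\<^sup>2
          - 2 * \<eta> * (1 - 2 * L * \<eta>) * gap y + 4 * L * \<eta>\<^sup>2 * gap x)"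
    unfolding expectation_inner_law_Suc
  proof (rule integral_mono[OF integrable integrable])
    fix y
    show "(\<Sum>i=1..n. (norm (y - learning_rate f m x *\<^sub>R direction x y i - xstar))\<^sup>2) / real n
        \<le> (norm (y - xstar))\<^sup>2 - 2 * \<eta> * (1 - 2 * L * \<eta>) * gap y + 4 * L * \<eta>\<^sup>2 * gap x"
      using sum_step_distance_le[OF assms(2), of y x] n_pos
      by (simp add: divide_le_eq \<eta>_def mult.commute)
  qed
  also have "\<dots> = measure_pmf.expectation (inner_law m x t) (\<lambda>y. (norm (y - xstar))\<^sup>2)
      - 2 * \<eta> * (1 - 2 * L * \<eta>) * measure_pmf.expectation (inner_law m x t) gap
      + 4 * L * \<eta>\<^sup>2 * gap x"
    by (subst Bochner_Integration.integral_add[OF integrable integrable],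
        subst Bochner_Integration.integral_diff[OF integrable integrable])
       (simp del: Bochner_Integration.integral_diff)
  finally show ?thesis .
qed

text \<open>The sum telescopes in the expected squared distances; the last of them is dropped and the
  first is bounded by strong convexity.\<close>

lemma sum_expected_gap_le:
  fixes m :: nat and x :: 'a
  defines "\<eta> \<equiv> learning_rate f m x"
  assumes "\<eta> \<ge> 0"
  shows "2 * \<eta> * (1 - 2 * L * \<eta>) * (\<Sum>t<N. measure_pmf.expectation (inner_law m x t) gap)
    \<le> (2 / \<mu> + 4 * L * \<eta>\<^sup>2 * real N) * gap x"
proof -
  let ?D = "\<lambda>t. measure_pmf.expectation (inner_law m x t) (\<lambda>y. (norm (y - xstar))\<^sup>2)"
  have "?D N + 2 * \<eta> * (1 - 2 * L * \<eta>) * (\<Sum>t<N. measure_pmf.expectation (inner_law m x t) gap)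
      \<le> ?D 0 + 4 * L * \<eta>\<^sup>2 * real N * gap x"
  proof (induction N)
    case (Suc N)
    then show ?case
      using expectation_distance_step[of m x N] assms(2)
      by (simp del: inner_law.simps add: \<eta>_def algebra_simps)
  qed simp
  moreover have "?D 0 \<le> 2 / \<mu> * gap x"
    using distance_le_gap[of x] by simp
  moreover have "0 \<le> ?D N"
    by (intro Bochner_Integration.integral_nonneg) simp
  ultimately show ?thesis
    unfolding distrib_right by linarith
qed

section \<open>Contraction of the expected gap\<close>

lemma finite_ssm_step: "m \<ge> 1 \<Longrightarrow> finite (set_pmf (ssm_step n fs m x))"
  using finite_lists_length_eq[of "{1..n}" m]
  by (auto simp: ssm_step_def set_replicate_pmf lists_eq_set set_pmf_component_index
      simp del: One_nat_def)

lemma finite_ssm: "m \<ge> 1 \<Longrightarrow> finite (set_pmf (ssm n fs m x k))"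
  by (induction k) (auto simp: finite_ssm_step)

text \<open>The stopping index and the sampled indices are independent, so the stopping index can be drawn
  first.\<close>

lemma expectation_ssm_step:
  fixes h :: "'a \<Rightarrow> real"
  assumes "m \<ge> 1"
  shows "measure_pmf.expectation (ssm_step n fs m x) h
    = (\<Sum>t<m. measure_pmf.expectation (inner_law m x t) h) / real m"
proof -
  have "ssm_step n fs m x = do {
      t \<leftarrow> pmf_of_set {0..<m};
      map_pmf (\<lambda>js. inner_iterate n fs m x js t) (replicate_pmf m (pmf_of_set {1..n}))}"
    unfolding ssm_step_def map_pmf_def by (rule bind_commute_pmf)
  also have "\<dots> = pmf_of_set {0..<m} \<bind> inner_law m x"
    using assms by (intro bind_pmf_cong map_pmf_inner_iterate) auto
  finally show ?thesis
    using assms finite_inner_law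
    by (simp only:, subst pmf_expectation_bind_pmf_of_set)
       (auto simp: divide_inverse mult.commute atLeast0LessThan lessThan_empty_iff simp flip: sum_distrib_left)
qed

text \<open>At a stationary point, the defining quotient of the learning rate has numerator and denominator
  0 and so takes the value 0; the inner loop does not move.\<close>

lemma inner_law_stationary: "gradient f x = 0 \<Longrightarrow> inner_law m x t = return_pmf x"
  by (induction t) (simp_all add: learning_rate_def bind_return_pmf)

lemma gap_zero_if_stationary:
  assumes "gradient f x = 0"
  shows "gap x = 0"
  using gap_le_inner[of x] gap_nonneg[of x] assms by simp

text \<open>With \<open>u = \<kappa> / s\<close>, the summed estimate of the inner loop yields
  \<open>(1 - 2 * u) * E \<le> (u + 2 * u) * gap x\<close> for the expected gap \<open>E\<close> after the step: the lower bound
  on the learning rate controls the contribution of the initial distance, and the upper bound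
  controls the variance.\<close>

lemma expectation_ssm_step_gap_le:
  fixes m :: nat
  defines "\<kappa> \<equiv> L / \<mu>" and "s \<equiv> sqrt (real m)"
  assumes "m \<ge> 1" and large: "s > 2 * \<kappa>"
  shows "measure_pmf.expectation (ssm_step n fs m x) gap \<le> 3 * \<kappa> / (s - 2 * \<kappa>) * gap x"
proof (cases "gradient f x = 0")
  case True
  then show ?thesis
    using gap_zero_if_stationary \<open>m \<ge> 1\<close> by (simp add: expectation_ssm_step inner_law_stationary)
next
  case False
  define \<eta> where "\<eta> = learning_rate f m x"
  define E where "E = measure_pmf.expectation (ssm_step n fs m x) gap"
  have s: "s > 0" "s * s = real m"
    using \<open>m \<ge> 1\<close> by (auto simp: s_def)
  have eta: "1 / (s * L) \<le> \<eta>" "\<eta> \<le> 1 / (s * \<mu>)"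
    unfolding \<eta>_def s_def using False \<open>m \<ge> 1\<close> learning_rate_bounds by auto
  then have eta_pos: "\<eta> > 0"
    using s L_pos by (meson divide_pos_pos less_le_trans mult_pos_pos zero_less_one)
  have "0 \<le> E"
    unfolding E_def by (intro Bochner_Integration.integral_nonneg gap_nonneg)
  \<comment> \<open>Both sides of the summed estimate contain the positive factor \<open>2 * \<eta> * m\<close>.\<close>
  have "2 / \<mu> + 4 * L * \<eta>\<^sup>2 * real m
      = (2 * \<eta> * real m) * (1 / (\<mu> * \<eta> * real m) + 2 * (L * \<eta>))"
    using eta_pos \<mu>_pos \<open>m \<ge> 1\<close> by (simp add: field_simps power2_eq_square)
  moreover have "2 * \<eta> * (1 - 2 * L * \<eta>) * (real m * E)
      = (2 * \<eta> * real m) * ((1 - 2 * (L * \<eta>)) * E)"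
    by (simp add: mult_ac)
  moreover have "2 * \<eta> * (1 - 2 * L * \<eta>) * (real m * E) \<le> (2 / \<mu> + 4 * L * \<eta>\<^sup>2 * real m) * gap x"
    using sum_expected_gap_le[of m x m] eta_pos \<open>m \<ge> 1\<close>
    by (simp add: E_def \<eta>_def expectation_ssm_step)
  ultimately have "(2 * \<eta> * real m) * ((1 - 2 * (L * \<eta>)) * E)
      \<le> (2 * \<eta> * real m) * ((1 / (\<mu> * \<eta> * real m) + 2 * (L * \<eta>)) * gap x)"
    by (simp only: mult.assoc)
  then have "(1 - 2 * (L * \<eta>)) * E \<le> (1 / (\<mu> * \<eta> * real m) + 2 * (L * \<eta>)) * gap x"
    using eta_pos \<open>m \<ge> 1\<close> by (subst (asm) mult_le_cancel_left_pos) auto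
  moreover have "L * \<eta> \<le> \<kappa> / s"
    using mult_left_mono[OF eta(2), of L] L_pos by (simp add: \<kappa>_def mult.commute)
  moreover have "1 / (\<mu> * \<eta> * real m) \<le> \<kappa> / s"
  proof -
    have "1 \<le> s * L * \<eta>"
      using eta(1) s L_pos by (simp add: field_simps)
    then have "1 / (\<mu> * \<eta> * real m) \<le> s * L * \<eta> / (\<mu> * \<eta> * real m)"
      using eta_pos \<mu>_pos by (intro divide_right_mono) auto
    also have "\<dots> = \<kappa> / s"
      using eta_pos \<mu>_pos s \<open>m \<ge> 1\<close> by (simp add: \<kappa>_def field_simps)
    finally show ?thesis .
  qed
  ultimately have "(1 - 2 * (\<kappa> / s)) * E \<le> (\<kappa> / s + 2 * (\<kappa> / s)) * gap x"
    using \<open>0 \<le> E\<close> gap_nonneg[of x]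
    by (smt (verit) mult_right_mono)
  moreover have "1 - 2 * (\<kappa> / s) = (s - 2 * \<kappa>) / s" "\<kappa> / s + 2 * (\<kappa> / s) = 3 * \<kappa> / s"
    using s(1) by (simp_all add: field_simps)
  ultimately have "(s - 2 * \<kappa>) * E / s \<le> 3 * \<kappa> * gap x / s"
    by simp
  then have "(s - 2 * \<kappa>) * E \<le> 3 * \<kappa> * gap x"
    using s(1) by (simp add: divide_le_cancel)
  then show ?thesis
    using large by (simp add: E_def field_simps)
qed

lemma expectation_ssm_gap_le:
  assumes "m \<ge> 1" and "\<rho> \<ge> 0"
    and step: "\<And>x. measure_pmf.expectation (ssm_step n fs m x) gap \<le> \<rho> * gap x"
  shows "measure_pmf.expectation (ssm n fs m x k) gap \<le> \<rho> ^ k * gap x"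
proof (induction k)
  case (Suc k)
  have "measure_pmf.expectation (ssm n fs m x (Suc k)) gap
      = measure_pmf.expectation (ssm n fs m x k) (\<lambda>y. measure_pmf.expectation (ssm_step n fs m y) gap)"
    using finite_ssm finite_ssm_step \<open>m \<ge> 1\<close> by (simp add: expectation_bind_finite)
  also have "\<dots> \<le> measure_pmf.expectation (ssm n fs m x k) (\<lambda>y. \<rho> * gap y)"
    using finite_ssm \<open>m \<ge> 1\<close> by (intro integral_mono integrable_measure_pmf_finite step)
  also have "\<dots> = \<rho> * measure_pmf.expectation (ssm n fs m x k) gap"
    by (rule integral_mult_right_zero)
  also have "\<dots> \<le> \<rho> ^ Suc k * gap x"
    using mult_left_mono[OF Suc.IH \<open>\<rho> \<ge> 0\<close>] by (simp add: mult.assoc)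
  finally show ?case .
qed simp

end

theorem corollary3p7:
  fixes n m :: nat
    and fs :: "nat \<Rightarrow> real ^ 'd \<Rightarrow> real"
    and f :: "real ^ 'd \<Rightarrow> real"
    and \<mu> L \<kappa> \<rho> :: real
    and xstar x0 :: "real ^ 'd"
    and k :: nat
  assumes "n \<ge> 1"
    and "f = avg n fs"
    and "\<And>i x. i \<in> {1..n} \<Longrightarrow> fs i differentiable (at x)"
    and "\<And>i. i \<in> {1..n} \<Longrightarrow> convex_on UNIV (fs i)"
    and "\<mu> > 0" and "L > 0"
    and "\<And>v w. f w \<ge> f v + inner (gradient f v) (w - v) + \<mu> / 2 * (norm (v - w))\<^sup>2"
    and "\<And>i v w. i \<in> {1..n} \<Longrightarrow>
           norm (gradient (fs i) v - gradient (fs i) w) \<le> L * norm (v - w)"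
    and "is_arg_min f (\<lambda>_. True) xstar"
    and "\<kappa> = L / \<mu>"
    and "m \<ge> 1"
    and "\<rho> = (\<kappa> + 4 * (1 + 1 / real m) * \<kappa>) / (sqrt (real m) - 4 * \<kappa>)"
    and "sqrt (real m) > 4 * \<kappa>"
    and "\<rho> < 1"
  shows "measure_pmf.expectation (ssm n fs m x0 k) (\<lambda>x. f x - f xstar) \<le> \<rho> ^ k * (f x0 - f xstar)"
proof -
  interpret finite_sum_minimization n fs \<mu> L xstar
    using assms(1,3-9) unfolding assms(2)
    by unfold_locales (auto simp: is_arg_min_linorder)
  define s where "s = sqrt (real m)"
  have "\<kappa> > 0" and s: "s > 4 * \<kappa>"
    using assms by (simp_all add: s_def)
  have "3 * \<kappa> / (s - 2 * \<kappa>) \<le> 3 * \<kappa> / (s - 4 * \<kappa>)"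
    using \<open>\<kappa> > 0\<close> s by (intro divide_left_mono) auto
  \<comment> \<open>The numerator of \<open>\<rho>\<close> is at least \<open>5 * \<kappa>\<close>.\<close>
  also have "\<dots> \<le> \<rho>"
    unfolding assms(12) s_def[symmetric] using \<open>\<kappa> > 0\<close> s
    by (intro divide_right_mono) (auto simp: algebra_simps)
  finally have rate: "3 * \<kappa> / (s - 2 * \<kappa>) \<le> \<rho>" .
  have "0 \<le> 3 * \<kappa> / (s - 2 * \<kappa>)"
    using \<open>\<kappa> > 0\<close> s by simp
  with rate have "\<rho> \<ge> 0" by simp
  have "measure_pmf.expectation (ssm_step n fs m x) (\<lambda>y. avg n fs y - avg n fs xstar)
      \<le> \<rho> * (avg n fs x - avg n fs xstar)" for x
  proof -
    have "measure_pmf.expectation (ssm_step n fs m x) (\<lambda>y. avg n fs y - avg n fs xstar)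
        \<le> 3 * \<kappa> / (s - 2 * \<kappa>) * (avg n fs x - avg n fs xstar)"
      using expectation_ssm_step_gap_le[of m x] \<open>m \<ge> 1\<close> \<open>\<kappa> > 0\<close> s
      by (simp add: s_def \<open>\<kappa> = L / \<mu>\<close>)
    also have "\<dots> \<le> \<rho> * (avg n fs x - avg n fs xstar)"
      by (intro mult_right_mono rate gap_nonneg)
    finally show ?thesis .
  qed
  then show ?thesis
    unfolding assms(2) by (intro expectation_ssm_gap_le \<open>m \<ge> 1\<close> \<open>\<rho> \<ge> 0\<close>)
qed

end
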